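(* Let $\mathcal{O}$ be a non-symmetric operad and $\pi\in\mathcal{O}(2)$ a multiplication on $\mathcal{O}$. If $H^2(\mathcal{O},d_\pi)=0$, then the multiplication $\pi$ is rigid.
   Context: All vector spaces are over a field $\mathbb{K}$ of characteristic $0$. A non-symmetric operad is a collection $\mathcal{O}=\{\mathcal{O}(n)\}_{n\ge 1}$ of vector spaces with bilinear partial compositions $\circ_i:\mathcal{O}(m)\otimes\mathcal{O}(n)\to\mathcal{O}(m+n-1)$, $1\le i\le m$, such that for $f\in\mathcal{O}(m), g\in\mathcal{O}(n), h\in\mathcal{O}(p)$: $(f\circ_i g)\circ_{i+j-1}h=f\circ_i(g\circ_j h)$ for $1\le i\le m,\ 1\le j\le n$; $(f\circ_i g)\circ_{j+n-1}h=(f\circ_j h)\circ_i g$ for $1\le i<j\le m$; and an element $\mathrm{id}\in\mathcal{O}(1)$ with $f\circ_i\mathrm{id}=f=\mathrm{id}\circ_1 f$. For $f\in\mathcal{O}(n)$ put $|f|=n-1$. For $f \in \mathcal{O}(2)$ and $g,h\in\mathcal{O}(1)$ write $\gamma(f;g,h)=(f\circ_2 h)\circ_1 g$. The circle product is $f\circ g=\sum_{i=1}^m(-1)^{(i-1)|g|}f\circ_i g$ for $f\in\mathcal{O}(m)$. A multiplication on $\mathcal{O}$ is an element $\pi\in\mathcal{O}(2)$ with $\pi\circ\pi=0$. It defines a differential $d_\pi:\mathcal{O}(n)\to\mathcal{O}(n+1)$, $d_\pi f=\pi\circ f-(-1)^{|f|}f\circ\pi$, and $H^n(\mathcal{O},d_\pi)$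 denotes the cohomology at $\mathcal{O}(n)$. All operations are extended $\mathbb{K}[[t]]$-linearly to formal power series $\mathcal{O}(n)[[t]]$. A (formal one-parameter) deformation of $\pi$ is $\pi_t=\sum_{i\ge0}\pi_it^i\in\mathcal{O}(2)[[t]]$ with $\pi_0=\pi$ and $\pi_t\circ\pi_t=0$. Two deformations $\pi_t,\pi_t'$ are equivalent if there is $\phi_t=\sum_{i\ge0}\phi_it^i\in\mathcal{O}(1)[[t]]$ with $\phi_0=\mathrm{id}$ and $\phi_t\circ\pi_t'=\gamma(\pi_t;\phi_t,\phi_t)$. The multiplication $\pi$ is rigid if every deformation of $\pi$ is equivalent to the constant deformation $\pi_t'=\pi$. *)

theory Defs
  imports "HOL-Computational_Algebra.Formal_Power_Series"
begin

text \<open>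
  The spaces \<open>Op n\<close> (\<open>n \<ge> 1\<close>) of an operad are subspaces of one ambient vector space, which is no
  restriction: take the direct sum of the family.  The \<open>Op n\<close> may overlap, so arities are explicit
  arguments: \<open>pc m n i f g\<close> is the partial composition of \<open>f \<in> Op m\<close> and \<open>g \<in> Op n\<close> at position
  \<open>i\<close>.  Nothing is assumed about \<open>Op 0\<close>, nor about \<open>pc\<close> outside \<open>1 \<le> i \<le> m\<close>, \<open>1 \<le> n\<close>.
\<close>

locale ns_operad = vector_space scale
  for scale :: "'k::field_char_0 \<Rightarrow> 'a::ab_group_add \<Rightarrow> 'a" +
  fixes Op :: "nat \<Rightarrow> 'a set"
    and pc :: "nat \<Rightarrow> nat \<Rightarrow> nat \<Rightarrow> 'a \<Rightarrow> 'a \<Rightarrow> 'a"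
    and ident :: 'a
  assumes subspace_Op: "1 \<le> n \<Longrightarrow> subspace (Op n)"
    and pc_closed: "\<lbrakk>1 \<le> i; i \<le> m; 1 \<le> n; f \<in> Op m; g \<in> Op n\<rbrakk> \<Longrightarrow> pc m n i f g \<in> Op (m + n - 1)"
    and pc_add_left: "\<lbrakk>1 \<le> i; i \<le> m; 1 \<le> n; f \<in> Op m; f' \<in> Op m; g \<in> Op n\<rbrakk> \<Longrightarrow>
      pc m n i (f + f') g = pc m n i f g + pc m n i f' g"
    and pc_scale_left: "\<lbrakk>1 \<le> i; i \<le> m; 1 \<le> n; f \<in> Op m; g \<in> Op n\<rbrakk> \<Longrightarrow>
      pc m n i (scale c f) g = scale c (pc m n i f g)"
    and pc_add_right: "\<lbrakk>1 \<le> i; i \<le> m; 1 \<le> n; f \<in> Op m; g \<in> Op n; g' \<in> Op n\<rbrakk> \<Longrightarrow>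
      pc m n i f (g + g') = pc m n i f g + pc m n i f g'"
    and pc_scale_right: "\<lbrakk>1 \<le> i; i \<le> m; 1 \<le> n; f \<in> Op m; g \<in> Op n\<rbrakk> \<Longrightarrow>
      pc m n i f (scale c g) = scale c (pc m n i f g)"
    and pc_sequential: "\<lbrakk>1 \<le> i; i \<le> m; 1 \<le> j; j \<le> n; 1 \<le> p; f \<in> Op m; g \<in> Op n; h \<in> Op p\<rbrakk> \<Longrightarrow>
      pc (m + n - 1) p (i + j - 1) (pc m n i f g) h = pc m (n + p - 1) i f (pc n p j g h)"
    and pc_parallel: "\<lbrakk>1 \<le> i; i < j; j \<le> m; 1 \<le> n; 1 \<le> p; f \<in> Op m; g \<in> Op n; h \<in> Op p\<rbrakk> \<Longrightarrow>
      pc (m + n - 1) p (j + n - 1) (pc m n i f g) h = pc (m + p - 1) n i (pc m p j f h) g"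
    and ident_closed: "ident \<in> Op 1"
    and pc_ident_right: "\<lbrakk>1 \<le> i; i \<le> m; f \<in> Op m\<rbrakk> \<Longrightarrow> pc m 1 i f ident = f"
    and pc_ident_left: "\<lbrakk>1 \<le> m; f \<in> Op m\<rbrakk> \<Longrightarrow> pc 1 m 1 ident f = f"
begin

definition circle :: "nat \<Rightarrow> nat \<Rightarrow> 'a \<Rightarrow> 'a \<Rightarrow> 'a" where
  "circle m n f g = (\<Sum>i = 1..m. scale ((-1) ^ ((i - 1) * (n - 1))) (pc m n i f g))"

definition multiplication :: "'a \<Rightarrow> bool" where
  "multiplication \<pi> \<longleftrightarrow> \<pi> \<in> Op 2 \<and> circle 2 2 \<pi> \<pi> = 0"

definition differential :: "'a \<Rightarrow> nat \<Rightarrow> 'a \<Rightarrow> 'a" where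
  "differential \<pi> n f = circle 2 n \<pi> f - scale ((-1) ^ (n - 1)) (circle n 2 f \<pi>)"

definition cocycles :: "'a \<Rightarrow> nat \<Rightarrow> 'a set" where
  "cocycles \<pi> n = {f \<in> Op n. differential \<pi> n f = 0}"

text \<open>The complex starts in degree 1, so there are no nonzero coboundaries there.\<close>

definition coboundaries :: "'a \<Rightarrow> nat \<Rightarrow> 'a set" where
  "coboundaries \<pi> n = (if n \<le> 1 then {0} else differential \<pi> (n - 1) ` Op (n - 1))"

text \<open>
  The cohomology is the set of cosets of the coboundaries in the cocycles; its zero element is the
  coset \<open>coboundaries \<pi> n\<close> itself.
\<close>

definition cohomology :: "'a \<Rightarrow> nat \<Rightarrow> 'a set set" where
  "cohomology \<pi> n = (\<lambda>z. (\<lambda>b. z + b) ` coboundaries \<pi> n) ` cocycles \<pi> n"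

text \<open>
  An element of \<open>Op n [[t]]\<close> is a power series over the ambient space with all coefficients in
  \<open>Op n\<close>.  A bilinear operation extends to power series by the Cauchy product.
\<close>

definition fps_Op :: "nat \<Rightarrow> 'a fps set" where
  "fps_Op n = {F. \<forall>i. fps_nth F i \<in> Op n}"

definition fps_bilinear_ext :: "('a \<Rightarrow> 'a \<Rightarrow> 'a) \<Rightarrow> 'a fps \<Rightarrow> 'a fps \<Rightarrow> 'a fps" where
  "fps_bilinear_ext B F G = Abs_fps (\<lambda>k. \<Sum>j = 0..k. B (fps_nth F j) (fps_nth G (k - j)))"

definition fps_pc :: "nat \<Rightarrow> nat \<Rightarrow> nat \<Rightarrow> 'a fps \<Rightarrow> 'a fps \<Rightarrow> 'a fps" where
  "fps_pc m n i = fps_bilinear_ext (pc m n i)"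

definition fps_circle :: "nat \<Rightarrow> nat \<Rightarrow> 'a fps \<Rightarrow> 'a fps \<Rightarrow> 'a fps" where
  "fps_circle m n = fps_bilinear_ext (circle m n)"

text \<open>\<open>\<gamma>(F; G, H)\<close> for \<open>F\<close> of arity 2 and \<open>G\<close>, \<open>H\<close> of arity 1.\<close>

definition fps_gamma :: "'a fps \<Rightarrow> 'a fps \<Rightarrow> 'a fps \<Rightarrow> 'a fps" where
  "fps_gamma F G H = fps_pc 2 1 1 (fps_pc 2 1 2 F H) G"

definition deformation :: "'a \<Rightarrow> 'a fps \<Rightarrow> bool" where
  "deformation \<pi> P \<longleftrightarrow> P \<in> fps_Op 2 \<and> fps_nth P 0 = \<pi> \<and> fps_circle 2 2 P P = 0"

definition equivalent_deformations :: "'a fps \<Rightarrow> 'a fps \<Rightarrow> bool" where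
  "equivalent_deformations P P' \<longleftrightarrow>
    (\<exists>\<phi> \<in> fps_Op 1. fps_nth \<phi> 0 = ident \<and> fps_circle 1 2 \<phi> P' = fps_gamma P \<phi> \<phi>)"

definition rigid :: "'a \<Rightarrow> bool" where
  "rigid \<pi> \<longleftrightarrow> (\<forall>P. deformation \<pi> P \<longrightarrow> equivalent_deformations P (fps_const \<pi>))"

end

end

theory Submission
  imports Defs
begin

text \<open>
  The power series over an operad form an operad again, so the operad identities may be applied to
  series.  A solution \<open>\<phi>\<close> of \<open>\<phi> \<circ> \<pi> = \<gamma>(P; \<phi>, \<phi>)\<close> is built coefficient by coefficient.  If the two
  sides agree below order \<open>n\<close>, expanding \<open>\<gamma>(P; \<gamma>(P; \<phi>, \<phi>), \<phi>) = \<gamma>(P; \<phi>, \<gamma>(P; \<phi>, \<phi>))\<close> shows that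
  their difference at order \<open>n\<close> is a 2-cocycle.  Changing the \<open>n\<close>-th coefficient of \<open>\<phi>\<close> by \<open>\<psi>\<close>
  changes this difference by \<open>- d\<^sub>\<pi> \<psi>\<close>, so it can be removed when the second cohomology vanishes.
\<close>

context ns_operad
begin

text \<open>Arities stay in the form \<open>1\<close> instead of \<open>Suc 0\<close>, as in the
  operad axioms, so that these match during simplification.\<close>

declare One_nat_def [simp del] One_nat_def [symmetric, simp]

section \<open>Linearity of the partial compositions\<close>

lemma
  assumes "1 \<le> n"
  shows Op_zero: "0 \<in> Op n"
    and Op_add: "f \<in> Op n \<Longrightarrow> g \<in> Op n \<Longrightarrow> f + g \<in> Op n"
    and Op_scale: "f \<in> Op n \<Longrightarrow> scale c f \<in> Op n"
    and Op_diff: "f \<in> Op n \<Longrightarrow> g \<in> Op n \<Longrightarrow> f - g \<in> Op n"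
    and Op_sum: "(\<And>x. x \<in> A \<Longrightarrow> h x \<in> Op n) \<Longrightarrow> sum h A \<in> Op n"
  using subspace_Op[OF assms]
  by (auto intro: subspace_0 subspace_add subspace_scale subspace_diff subspace_sum)

context
  fixes i m n :: nat
  assumes i: "1 \<le> i" "i \<le> m" and n: "1 \<le> n"
begin

lemma pc_zero_left: "g \<in> Op n \<Longrightarrow> pc m n i 0 g = 0"
  using pc_scale_left[OF i n, of 0 g 0] i Op_zero[of m] by simp

lemma pc_zero_right: "f \<in> Op m \<Longrightarrow> pc m n i f 0 = 0"
  using pc_scale_right[OF i n, of f 0 0] n Op_zero[of n] by simp

lemma pc_diff_left:
  assumes "f \<in> Op m" "f' \<in> Op m" "g \<in> Op n"
  shows "pc m n i (f - f') g = pc m n i f g - pc m n i f' g"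
  using pc_add_left[OF i n, of "f - f'" f' g] assms i Op_diff[of m f f'] by (simp add: algebra_simps)

lemma pc_diff_right:
  assumes "f \<in> Op m" "g \<in> Op n" "g' \<in> Op n"
  shows "pc m n i f (g - g') = pc m n i f g - pc m n i f g'"
  using pc_add_right[OF i n, of f "g - g'" g'] assms n Op_diff[of n g g'] by (simp add: algebra_simps)

lemma pc_sum_left:
  assumes "\<And>x. x \<in> A \<Longrightarrow> h x \<in> Op m" "g \<in> Op n"
  shows "pc m n i (sum h A) g = (\<Sum>x\<in>A. pc m n i (h x) g)"
  using assms i n
  by (induction A rule: infinite_finite_induct)
    (simp_all add: pc_zero_left pc_add_left[OF i n] Op_sum)

lemma pc_sum_right:
  assumes "\<And>x. x \<in> A \<Longrightarrow> h x \<in> Op n" "f \<in> Op m"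
  shows "pc m n i f (sum h A) = (\<Sum>x\<in>A. pc m n i f (h x))"
  using assms i n
  by (induction A rule: infinite_finite_induct)
    (simp_all add: pc_zero_right pc_add_right[OF i n] Op_sum)

end

section \<open>Arities one and two: associativity, the differential and the cocycle identity\<close>

lemma circle_1: "circle 1 n f g = pc 1 n 1 f g"
  by (simp add: circle_def)

lemma circle_2: "circle 2 n f g = pc 2 n 1 f g + scale ((-1) ^ (n - 1)) (pc 2 n 2 f g)"
proof -
  have "{1..2} = {1, 2 :: nat}"
    by auto
  then show ?thesis
    by (simp add: circle_def)
qed

lemma differential_1:
  "differential \<pi> 1 f = pc 2 1 1 \<pi> f + pc 2 1 2 \<pi> f - pc 1 2 1 f \<pi>"
  by (simp add: differential_def circle_1 circle_2)

lemma differential_2: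
  "differential \<pi> 2 f = pc 2 2 1 \<pi> f - pc 2 2 2 \<pi> f + pc 2 2 1 f \<pi> - pc 2 2 2 f \<pi>"
  by (simp add: differential_def circle_2)

text \<open>The sign at position 2 is -1, so the circle square of \<open>\<pi>\<close> is its
  associator.\<close>

lemma multiplication_iff_associative:
  "multiplication \<pi> \<longleftrightarrow> \<pi> \<in> Op 2 \<and> pc 2 2 1 \<pi> \<pi> = pc 2 2 2 \<pi> \<pi>"
  by (simp add: multiplication_def circle_2)

text \<open>If every coset of a cocycle is the subspace of coboundaries itself, then
  \<open>z + 0\<close> lies in that subspace.\<close>

lemma coboundary_if_cohomology_2_trivial:
  assumes "\<pi> \<in> Op 2" "cohomology \<pi> 2 = {coboundaries \<pi> 2}" "z \<in> Op 2" "differential \<pi> 2 z = 0"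
  obtains f where "f \<in> Op 1" "differential \<pi> 1 f = z"
proof -
  have cob: "coboundaries \<pi> 2 = differential \<pi> 1 ` Op 1"
    by (simp add: coboundaries_def)
  have "differential \<pi> 1 0 = 0"
    using assms(1) by (simp add: differential_1 pc_zero_left pc_zero_right)
  then have "0 \<in> coboundaries \<pi> 2"
    unfolding cob using Op_zero[of 1] by force
  moreover have "(\<lambda>b. z + b) ` coboundaries \<pi> 2 = coboundaries \<pi> 2"
    using assms(2-4) unfolding cohomology_def cocycles_def by blast
  ultimately have "z \<in> coboundaries \<pi> 2"
    by (metis add.right_neutral image_eqI)
  then show ?thesis
    using that cob by auto
qed

text \<open>Read as products, \<open>E(x,y) = \<phi>(Q(x,y)) - P(\<phi> x, \<phi> y)\<close>
  measures how far \<open>\<phi>\<close> is from a homomorphism from \<open>Q\<close> to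
  \<open>P\<close>. The claim is that \<open>P(E(x,y), \<phi> z) - P(\<phi> x, E(y,z)) + E(Q(x,y),z)
  - E(x,Q(y,z))\<close> vanishes: associativity of \<open>P\<close> and of \<open>Q\<close> removes
  the pure terms, and the mixed terms cancel in pairs. It is an exact identity in any operad, so it
  can be used for series before any coefficient is taken.\<close>

lemma defect_cocycle_identity:
  assumes "multiplication P" "multiplication Q" "\<phi> \<in> Op 1"
  defines "E \<equiv> pc 1 2 1 \<phi> Q - pc 2 1 1 (pc 2 1 2 P \<phi>) \<phi>"
  shows "pc 2 2 1 (pc 2 1 2 P \<phi>) E - pc 2 2 2 (pc 2 1 1 P \<phi>) E + pc 2 2 1 E Q - pc 2 2 2 E Q = 0"
proof -
  have P: "P \<in> Op 2" "pc 2 2 1 P P = pc 2 2 2 P P" and Q: "Q \<in> Op 2" "pc 2 2 1 Q Q = pc 2 2 2 Q Q"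
    using assms by (auto simp: multiplication_iff_associative)
  define L R G T where "L = pc 2 1 1 P \<phi>" and "R = pc 2 1 2 P \<phi>"
    and "G = pc 2 1 1 R \<phi>" and "T = pc 2 2 2 P P"
  note [simp] = P(1) Q(1) assms(3)
  have [simp]: "L \<in> Op 2" "R \<in> Op 2"
    using pc_closed[of _ 2 1 P \<phi>] by (auto simp: L_def R_def)
  have [simp]: "G \<in> Op 2" "pc 1 2 1 \<phi> Q \<in> Op 2" "T \<in> Op 3"
    using pc_closed[of 1 2 1 R \<phi>] pc_closed[of 1 1 2 \<phi> Q] pc_closed[of 2 2 2 P P]
    by (auto simp: G_def T_def)
  have [simp]: "pc 3 1 j T \<phi> \<in> Op 3" if "1 \<le> j" "j \<le> 3" for j
    using pc_closed[of j 3 1 T \<phi>] that by simp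
  \<comment> \<open>The two copies of \<open>\<phi>\<close> may enter \<open>P\<close> in either
    order. The left bracketing below uses this form of \<open>G\<close>, the right bracketing its
    definition.\<close>
  have G': "G = pc 2 1 2 L \<phi>"
    using pc_parallel[of 1 2 2 1 1 P \<phi> \<phi>] by (simp add: G_def L_def R_def)
  have T_swap: "pc 3 1 j (pc 3 1 i f \<phi>) \<phi> = pc 3 1 i (pc 3 1 j f \<phi>) \<phi>"
    if "1 \<le> i" "i < j" "j \<le> 3" "f \<in> Op 3" for i j f
    using pc_parallel[of i j 3 1 1 f \<phi> \<phi>] that by simp
  \<comment> \<open>Both bracketings of three arguments \<open>\<phi> x\<close>,
    \<open>\<phi> y\<close>, \<open>\<phi> z\<close> are reduced to the ternary operation
    \<open>T\<close> with \<open>\<phi>\<close> in each input; they then differ only in the order of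
    insertion.\<close>
  have RG: "pc 2 2 1 R G = pc 3 1 3 (pc 3 1 2 (pc 3 1 1 T \<phi>) \<phi>) \<phi>"
  proof -
    have "pc 2 2 1 R G = pc 3 1 3 (pc 2 2 1 P G) \<phi>"
      using pc_parallel[of 1 2 2 2 1 P G \<phi>] by (simp add: R_def)
    also have "pc 2 2 1 P G = pc 3 1 2 (pc 2 2 1 P L) \<phi>"
      using pc_sequential[of 1 2 2 2 1 P L \<phi>] by (simp add: G')
    \<comment> \<open>Here associativity of \<open>P\<close> enters: \<open>T\<close> is defined by
      the right bracketing, while the left one appears on this side.\<close>
    also have "pc 2 2 1 P L = pc 3 1 1 T \<phi>"
      using pc_sequential[of 1 2 1 2 1 P P \<phi>] P(2) by (simp add: L_def T_def)
    finally show ?thesis .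
  qed
  have LG: "pc 2 2 2 L G = pc 3 1 1 (pc 3 1 2 (pc 3 1 3 T \<phi>) \<phi>) \<phi>"
  proof -
    have "pc 2 2 2 L G = pc 3 1 1 (pc 2 2 2 P G) \<phi>"
      using pc_parallel[of 1 2 2 1 2 P \<phi> G] by (simp add: L_def)
    also have "pc 2 2 2 P G = pc 3 1 2 (pc 2 2 2 P R) \<phi>"
      using pc_sequential[of 2 2 1 2 1 P R \<phi>] by (simp add: G_def)
    also have "pc 2 2 2 P R = pc 3 1 3 T \<phi>"
      using pc_sequential[of 2 2 2 2 1 P P \<phi>] by (simp add: R_def T_def)
    finally show ?thesis .
  qed
  have "pc 2 2 1 R G = pc 2 2 2 L G"
    by (simp add: RG LG T_swap)
  \<comment> \<open>The mixed terms \<open>P(\<phi> Q(x,y), \<phi> z)\<close> and, next,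
    \<open>P(\<phi> x, \<phi> Q(y,z))\<close> each arise twice in the expansion, with opposite
    signs.\<close>
  moreover have "pc 2 2 1 R (pc 1 2 1 \<phi> Q) = pc 2 2 1 G Q"
    using pc_sequential[of 1 2 1 1 2 R \<phi> Q] by (simp add: G_def)
  moreover have "pc 2 2 2 L (pc 1 2 1 \<phi> Q) = pc 2 2 2 G Q"
    using pc_sequential[of 2 2 1 1 2 L \<phi> Q] by (simp add: G')
  moreover have "pc 2 2 1 (pc 1 2 1 \<phi> Q) Q = pc 2 2 2 (pc 1 2 1 \<phi> Q) Q"
    using pc_sequential[of 1 1 1 2 2 \<phi> Q Q] pc_sequential[of 1 1 2 2 2 \<phi> Q Q] Q(2)
    by simp
  moreover have "E = pc 1 2 1 \<phi> Q - G"
    by (simp add: E_def G_def R_def)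
  ultimately show ?thesis
    unfolding L_def[symmetric] R_def[symmetric] by (simp add: pc_diff_left pc_diff_right)
qed

section \<open>The operad of formal power series\<close>

definition fps_scale :: "'k \<Rightarrow> 'a fps \<Rightarrow> 'a fps" where
  "fps_scale c F = Abs_fps (\<lambda>k. scale c (fps_nth F k))"

lemma fps_scale_nth [simp]: "fps_nth (fps_scale c F) k = scale c (fps_nth F k)"
  by (simp add: fps_scale_def)

lemma fps_Op_nth: "F \<in> fps_Op n \<Longrightarrow> fps_nth F k \<in> Op n"
  by (simp add: fps_Op_def)

lemma fps_pc_nth:
  "fps_nth (fps_pc m n i F G) k = (\<Sum>j=0..k. pc m n i (fps_nth F j) (fps_nth G (k - j)))"
  by (simp add: fps_pc_def fps_bilinear_ext_def)

lemma fps_pc_closed: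
  assumes "1 \<le> i" "i \<le> m" "1 \<le> n" "F \<in> fps_Op m" "G \<in> fps_Op n"
  shows "fps_pc m n i F G \<in> fps_Op (m + n - 1)"
  using assms by (auto simp: fps_Op_def fps_pc_nth intro!: Op_sum pc_closed)

text \<open>Each coefficient of an axiom is a finite sum of instances of the same axiom in the
  original operad. Only the sequential and parallel axioms need work, since their triple sums must
  be regrouped. The interpretation makes all earlier lemmas available for series.\<close>

lemma ns_operad_fps: "ns_operad fps_scale fps_Op fps_pc (fps_const ident)"
proof -
  interpret V: vector_space fps_scale
    by unfold_locales (auto simp: fps_eq_iff scale_right_distrib scale_left_distrib)
  \<comment> \<open>Both sides sum \<open>A a b c\<close> over all \<open>a + b + c = k\<close>;
    this is the regrouping behind associativity of the Cauchy product.\<close>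
  have assoc_sum: "(\<Sum>j=0..k. \<Sum>i=0..j. A i (j - i) (k - j)) = (\<Sum>j=0..k. \<Sum>i=0..k - j. A j i (k - j - i))"
    for A :: "nat \<Rightarrow> nat \<Rightarrow> nat \<Rightarrow> 'a" and k
    by (rule fps_mult_assoc_lemma)
  show ?thesis
  proof (unfold_locales)
    fix n :: nat
    assume "1 \<le> n"
    then show "V.subspace (fps_Op n)"
      by (auto simp: V.subspace_def fps_Op_def Op_zero Op_add Op_scale)
  next
    show "fps_const ident \<in> fps_Op 1"
      using ident_closed Op_zero[of 1] by (simp add: fps_Op_def)
  next
    fix i m and F :: "'a fps"
    assume *: "1 \<le> i" "i \<le> m" "F \<in> fps_Op m"
    then have "pc m 1 i (fps_nth F j) (if k - j = 0 then ident else 0)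
        = (if j = k then fps_nth F k else 0)" if "j \<le> k" for j k
      using that by (auto simp: fps_Op_nth pc_ident_right pc_zero_right)
    then show "fps_pc m 1 i F (fps_const ident) = F"
      by (simp add: fps_eq_iff fps_pc_nth)
  next
    fix m and F :: "'a fps"
    assume *: "1 \<le> m" "F \<in> fps_Op m"
    then have "pc 1 m 1 (if j = 0 then ident else 0) (fps_nth F (k - j))
        = (if j = 0 then fps_nth F k else 0)" for j k
      by (auto simp: fps_Op_nth pc_ident_left pc_zero_left)
    then show "fps_pc 1 m 1 (fps_const ident) F = F"
      by (simp add: fps_eq_iff fps_pc_nth)
  next
    fix i m j n p :: nat and F G H :: "'a fps"
    assume *: "1 \<le> i" "i \<le> m" "1 \<le> j" "j \<le> n" "1 \<le> p" "F \<in> fps_Op m" "G \<in> fps_Op n" "H \<in> fps_Op p"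
    note mem = *(6-8)[THEN fps_Op_nth]
    show "fps_pc (m + n - 1) p (i + j - 1) (fps_pc m n i F G) H =
      fps_pc m (n + p - 1) i F (fps_pc n p j G H)"
    proof (rule fps_ext)
      fix k
      have "fps_nth (fps_pc (m + n - 1) p (i + j - 1) (fps_pc m n i F G) H) k =
        (\<Sum>b=0..k. \<Sum>a=0..b. pc (m + n - 1) p (i + j - 1) (pc m n i (fps_nth F a) (fps_nth G (b - a))) (fps_nth H (k - b)))"
        unfolding fps_pc_nth using * mem
        by (intro sum.cong refl pc_sum_left) (auto intro!: pc_closed)
      also have "\<dots> = (\<Sum>a=0..k. \<Sum>b=0..k-a. pc m (n + p - 1) i (fps_nth F a) (pc n p j (fps_nth G b) (fps_nth H (k - a - b))))"
        using * mem by (simp add: assoc_sum[where A = "\<lambda>a b c. pc m (n + p - 1) i (fps_nth F a) (pc n p j (fps_nth G b) (fps_nth H c))"] pc_sequential)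
      also have "\<dots> = fps_nth (fps_pc m (n + p - 1) i F (fps_pc n p j G H)) k"
        unfolding fps_pc_nth using * mem
        by (intro sum.cong refl pc_sum_right[symmetric]) (auto intro!: pc_closed)
      finally show "fps_nth (fps_pc (m + n - 1) p (i + j - 1) (fps_pc m n i F G) H) k = \<dots>" .
    qed
  next
    fix i j m n p :: nat and F G H :: "'a fps"
    assume *: "1 \<le> i" "i < j" "j \<le> m" "1 \<le> n" "1 \<le> p" "F \<in> fps_Op m" "G \<in> fps_Op n" "H \<in> fps_Op p"
    note mem = *(6-8)[THEN fps_Op_nth]
    show "fps_pc (m + n - 1) p (j + n - 1) (fps_pc m n i F G) H =
      fps_pc (m + p - 1) n i (fps_pc m p j F H) G"
    proof (rule fps_ext)
      fix k
      \<comment> \<open>The indices of \<open>F\<close>, \<open>G\<close>, \<open>H\<close> are kept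
        apart, so that the parallel axiom becomes a second formula for the same summand.\<close>
      define A where "A a b c = pc (m + n - 1) p (j + n - 1) (pc m n i (fps_nth F a) (fps_nth G b)) (fps_nth H c)" for a b c
      have A': "A a b c = pc (m + p - 1) n i (pc m p j (fps_nth F a) (fps_nth H c)) (fps_nth G b)" for a b c
        using * mem by (simp add: A_def pc_parallel)
      have "fps_nth (fps_pc (m + n - 1) p (j + n - 1) (fps_pc m n i F G) H) k = (\<Sum>b=0..k. \<Sum>a=0..b. A a (b - a) (k - b))"
        unfolding fps_pc_nth A_def using * mem
        by (intro sum.cong refl pc_sum_left) (auto intro!: pc_closed)
      also have "\<dots> = (\<Sum>a=0..k. \<Sum>b=0..k-a. A a b (k - a - b))"
        by (rule assoc_sum)
      \<comment> \<open>The right side composes with \<open>H\<close> before \<open>G\<close>, so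
        the inner sum is reflected to run over the index of \<open>H\<close>; regrouping backwards
        then joins \<open>a\<close> with \<open>c\<close>.\<close>
      also have "\<dots> = (\<Sum>a=0..k. \<Sum>c=0..k-a. A a (k - a - c) c)"
      proof (rule sum.cong[OF refl])
        fix a
        show "(\<Sum>b=0..k-a. A a b (k - a - b)) = (\<Sum>c=0..k-a. A a (k - a - c) c)"
          by (rule sum.reindex_bij_witness[of _ "\<lambda>c. k - a - c" "\<lambda>b. k - a - b"])
            (simp_all del: diff_diff_left)
      qed
      also have "\<dots> = (\<Sum>c=0..k. \<Sum>a=0..c. A a (k - c) (c - a))"
        by (rule assoc_sum[symmetric])
      also have "\<dots> = fps_nth (fps_pc (m + p - 1) n i (fps_pc m p j F H) G) k"
        unfolding fps_pc_nth A' using * mem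
        by (intro sum.cong refl pc_sum_left[symmetric]) (auto intro!: pc_closed)
      finally show "fps_nth (fps_pc (m + n - 1) p (j + n - 1) (fps_pc m n i F G) H) k = \<dots>" .
    qed
  qed (auto simp: fps_eq_iff fps_pc_nth fps_Op_nth pc_add_left pc_add_right pc_scale_left pc_scale_right
        sum.distrib scale_sum_right fps_pc_closed)
qed

section \<open>Leading coefficients of compositions and associative series\<close>

lemma fps_pc_leading_left:
  assumes "1 \<le> i" "i \<le> m" "1 \<le> n" "F \<in> fps_Op m" "G \<in> fps_Op n" "\<And>k. k < N \<Longrightarrow> fps_nth F k = 0"
  shows "k < N \<Longrightarrow> fps_nth (fps_pc m n i F G) k = 0"
    and "fps_nth (fps_pc m n i F G) N = pc m n i (fps_nth F N) (fps_nth G 0)"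
proof -
  \<comment> \<open>All terms with an index of \<open>F\<close> below \<open>N\<close> vanish, so at
    order \<open>N\<close> only \<open>j = N\<close> remains, paired with the constant term of
    \<open>G\<close>.\<close>
  have *: "pc m n i (fps_nth F j) (fps_nth G l) = 0" if "j < N" for j l
    using assms that by (simp add: pc_zero_left fps_Op_nth)
  then show "k < N \<Longrightarrow> fps_nth (fps_pc m n i F G) k = 0"
    by (simp add: fps_pc_nth)
  show "fps_nth (fps_pc m n i F G) N = pc m n i (fps_nth F N) (fps_nth G 0)"
    by (cases N) (simp_all add: fps_pc_nth *)
qed

lemma fps_pc_leading_right:
  assumes "1 \<le> i" "i \<le> m" "1 \<le> n" "F \<in> fps_Op m" "G \<in> fps_Op n" "\<And>k. k < N \<Longrightarrow> fps_nth G k = 0"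
  shows "k < N \<Longrightarrow> fps_nth (fps_pc m n i F G) k = 0"
    and "fps_nth (fps_pc m n i F G) N = pc m n i (fps_nth F 0) (fps_nth G N)"
proof -
  have *: "pc m n i (fps_nth F j) (fps_nth G l) = 0" if "l < N" for j l
    using assms that by (simp add: pc_zero_right fps_Op_nth)
  then show "k < N \<Longrightarrow> fps_nth (fps_pc m n i F G) k = 0"
    by (simp add: fps_pc_nth)
  show "fps_nth (fps_pc m n i F G) N = pc m n i (fps_nth F 0) (fps_nth G N)"
    by (simp add: fps_pc_nth sum.atLeast_Suc_atMost *)
qed

text \<open>The circle product extended to series and the one formed inside the series operad both
  give the associator of \<open>F\<close>. A deformation is therefore a multiplication in the series
  operad.\<close>

lemma fps_multiplication_iff:
  assumes "F \<in> fps_Op 2"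
  shows "ns_operad.multiplication fps_scale fps_Op fps_pc F \<longleftrightarrow> fps_circle 2 2 F F = 0"
proof -
  interpret F: ns_operad fps_scale fps_Op fps_pc "fps_const ident"
    by (rule ns_operad_fps)
  have "fps_nth (fps_circle 2 2 F F) k = fps_nth (fps_pc 2 2 1 F F) k - fps_nth (fps_pc 2 2 2 F F) k" for k
    by (simp add: fps_circle_def fps_bilinear_ext_def fps_pc_nth circle_2 sum_subtractf)
  then show ?thesis
    using assms by (simp add: F.multiplication_iff_associative fps_eq_iff)
qed

section \<open>The defect of a formal equivalence\<close>

lemma fps_const_mem_fps_Op: "1 \<le> n \<Longrightarrow> f \<in> Op n \<Longrightarrow> fps_const f \<in> fps_Op n"
  by (simp add: fps_Op_def Op_zero)

lemma fps_circle_fps_const: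
  assumes "multiplication \<pi>"
  shows "fps_circle 2 2 (fps_const \<pi>) (fps_const \<pi>) = 0"
proof -
  have \<pi>: "\<pi> \<in> Op 2" "circle 2 2 \<pi> \<pi> = 0"
    using assms by (auto simp: multiplication_def)
  then have "circle 2 2 f 0 = 0" "circle 2 2 0 f = 0" if "f \<in> Op 2" for f
    using that by (simp_all add: circle_2 pc_zero_left pc_zero_right)
  with \<pi> show ?thesis
    by (auto simp: fps_eq_iff fps_circle_def fps_bilinear_ext_def Op_zero intro!: sum.neutral)
qed

text \<open>This is the element \<open>E\<close> of \<open>defect_cocycle_identity\<close>, formed
  in the series operad.\<close>

definition fps_defect :: "'a fps \<Rightarrow> 'a fps \<Rightarrow> 'a fps \<Rightarrow> 'a fps" where
  "fps_defect P Q \<phi> = fps_pc 1 2 1 \<phi> Q - fps_gamma P \<phi> \<phi>"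

lemma equivalent_deformations_iff_defect:
  "equivalent_deformations P Q \<longleftrightarrow> (\<exists>\<phi>\<in>fps_Op 1. fps_nth \<phi> 0 = ident \<and> fps_defect P Q \<phi> = 0)"
proof -
  have "circle 1 2 = pc 1 2 1"
    by (intro ext circle_1)
  then show ?thesis
    by (simp add: equivalent_deformations_def fps_defect_def fps_circle_def fps_pc_def)
qed

lemma fps_defect_closed:
  assumes "P \<in> fps_Op 2" "Q \<in> fps_Op 2" "\<phi> \<in> fps_Op 1"
  shows "fps_defect P Q \<phi> \<in> fps_Op 2"
proof -
  interpret F: ns_operad fps_scale fps_Op fps_pc "fps_const ident"
    by (rule ns_operad_fps)
  show ?thesis
    using assms fps_pc_closed[of 1 1 2 \<phi> Q] fps_pc_closed[of 2 2 1 P \<phi>]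
      fps_pc_closed[of 1 2 1 "fps_pc 2 1 2 P \<phi>" \<phi>]
    by (simp add: fps_defect_def fps_gamma_def F.Op_diff)
qed

text \<open>As \<open>\<delta>\<close> starts at order \<open>N\<close> or later, every other factor
  enters at order \<open>N\<close> only through its constant term, which is \<open>\<pi>\<close> or
  \<open>ident\<close>. The change at order \<open>N\<close> is thus
  \<open>\<delta>\<circ>\<pi> - \<pi>\<circ>\<delta>\<close> with the \<open>N\<close>-th
  coefficient of \<open>\<delta>\<close>, that is, minus its differential.\<close>

lemma fps_defect_perturb:
  assumes P: "P \<in> fps_Op 2" and Q: "Q \<in> fps_Op 2" and \<phi>: "\<phi> \<in> fps_Op 1" "fps_nth \<phi> 0 = ident"
    and \<delta>: "\<delta> \<in> fps_Op 1" "\<And>k. k < N \<Longrightarrow> fps_nth \<delta> k = 0" and N: "0 < N"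
    and PQ: "fps_nth P 0 = \<pi>" "fps_nth Q 0 = \<pi>"
  shows "k < N \<Longrightarrow> fps_nth (fps_defect P Q (\<phi> + \<delta>)) k = fps_nth (fps_defect P Q \<phi>) k"
    and "fps_nth (fps_defect P Q (\<phi> + \<delta>)) N
      = fps_nth (fps_defect P Q \<phi>) N - differential \<pi> 1 (fps_nth \<delta> N)"
proof -
  interpret F: ns_operad fps_scale fps_Op fps_pc "fps_const ident"
    by (rule ns_operad_fps)
  define R R' where "R = fps_pc 2 1 2 P \<phi>" and "R' = fps_pc 2 1 2 P \<delta>"
  have R: "R \<in> fps_Op 2" "R' \<in> fps_Op 2"
    using fps_pc_closed[of 2 2 1 P \<phi>] fps_pc_closed[of 2 2 1 P \<delta>] P \<phi> \<delta> by (simp_all add: R_def R'_def)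
  have \<pi>: "\<pi> \<in> Op 2"
    using P PQ fps_Op_nth by blast
  have R0: "fps_nth R 0 = \<pi>"
    using \<phi> \<pi> PQ by (simp add: R_def fps_pc_nth pc_ident_right)
  have sum_mem: "\<phi> + \<delta> \<in> fps_Op 1" and sum_0: "fps_nth (\<phi> + \<delta>) 0 = ident"
    using \<phi> \<delta> N by (auto simp: F.Op_add)
  \<comment> \<open>The quadratic term in \<open>\<delta>\<close> stays inside the last summand:
    \<open>R'\<close> vanishes below order \<open>N\<close>, and \<open>\<phi> + \<delta>\<close>
    has constant term \<open>ident\<close> because \<open>N\<close> is positive.\<close>
  have expand: "fps_defect P Q (\<phi> + \<delta>)
    = fps_defect P Q \<phi> + (fps_pc 1 2 1 \<delta> Q - fps_pc 2 1 1 R \<delta> - fps_pc 2 1 1 R' (\<phi> + \<delta>))"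
    using P Q \<phi> \<delta> R sum_mem
    by (simp add: fps_defect_def fps_gamma_def F.pc_add_left F.pc_add_right F.Op_add
        R_def[symmetric] R'_def[symmetric])
  note low = fps_pc_leading_right[of 2 2 1 P \<delta> N, folded R'_def]
  have R'_low: "fps_nth R' k = 0" if "k < N" for k
    using low(1) P \<delta> that by simp
  have R'_N: "fps_nth R' N = pc 2 1 2 \<pi> (fps_nth \<delta> N)"
    using low(2) P \<delta> PQ by simp
  have R'_N_mem: "fps_nth R' N \<in> Op 2"
    using R by (simp add: fps_Op_nth)
  note l1 = fps_pc_leading_left[of 1 1 2 \<delta> Q N] and l2 = fps_pc_leading_right[of 1 2 1 R \<delta> N]
    and l3 = fps_pc_leading_left[of 1 2 1 R' "\<phi> + \<delta>" N]
  show "fps_nth (fps_defect P Q (\<phi> + \<delta>)) k = fps_nth (fps_defect P Q \<phi>) k" if "k < N"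
    unfolding expand using l1(1) l2(1) l3(1) that Q R \<delta> R'_low sum_mem by simp
  show "fps_nth (fps_defect P Q (\<phi> + \<delta>)) N
      = fps_nth (fps_defect P Q \<phi>) N - differential \<pi> 1 (fps_nth \<delta> N)"
    unfolding expand fps_add_nth[of "fps_defect P Q \<phi>"] fps_sub_nth
    using l1(2) l2(2) l3(2) Q R \<delta> R'_low sum_mem sum_0 R0 PQ R'_N R'_N_mem
    by (simp add: differential_1 pc_ident_right del: fps_add_nth)
qed

section \<open>Obstructions are cocycles and can be removed\<close>

lemma fps_defect_cocycle:
  assumes "multiplication \<pi>" "deformation \<pi> P" "\<phi> \<in> fps_Op 1" "fps_nth \<phi> 0 = ident"
    and "\<And>k. k < N \<Longrightarrow> fps_nth (fps_defect P (fps_const \<pi>) \<phi>) k = 0"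
  shows "differential \<pi> 2 (fps_nth (fps_defect P (fps_const \<pi>) \<phi>) N) = 0"
proof -
  interpret F: ns_operad fps_scale fps_Op fps_pc "fps_const ident"
    by (rule ns_operad_fps)
  define Q where "Q = fps_const \<pi>"
  define E where "E = fps_defect P Q \<phi>"
  define L R where "L = fps_pc 2 1 1 P \<phi>" and "R = fps_pc 2 1 2 P \<phi>"
  have \<pi>: "\<pi> \<in> Op 2" "P \<in> fps_Op 2" "fps_nth P 0 = \<pi>"
    using assms by (auto simp: multiplication_def deformation_def)
  then have Q: "Q \<in> fps_Op 2"
    by (simp add: Q_def fps_const_mem_fps_Op)
  have "F.multiplication P" "F.multiplication Q"
    using assms \<pi> Q fps_circle_fps_const
    by (simp_all add: fps_multiplication_iff deformation_def Q_def)
  note identity = F.defect_cocycle_identity[OF this assms(3), folded fps_gamma_def fps_defect_def L_def R_def E_def]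
  have LR: "L \<in> fps_Op 2" "R \<in> fps_Op 2"
    using fps_pc_closed[of 1 2 1 P \<phi>] fps_pc_closed[of 2 2 1 P \<phi>] \<pi> assms by (simp_all add: L_def R_def)
  have LR0: "fps_nth L 0 = \<pi>" "fps_nth R 0 = \<pi>"
    using \<pi> assms by (simp_all add: L_def R_def fps_pc_nth pc_ident_right)
  have E: "E \<in> fps_Op 2" "\<And>k. k < N \<Longrightarrow> fps_nth E k = 0"
    using fps_defect_closed \<pi> Q assms by (auto simp: E_def Q_def)
  have Q0: "fps_nth Q 0 = \<pi>"
    by (simp add: Q_def)
  \<comment> \<open>The exact identity is read at order \<open>N\<close>. Since \<open>E\<close>
    vanishes below \<open>N\<close>, only the constant terms of \<open>L\<close>, \<open>R\<close>
    and \<open>Q\<close> meet it, and all three are \<open>\<pi>\<close>; the four terms become the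
    differential of the \<open>N\<close>-th coefficient.\<close>
  have "fps_nth (fps_pc 2 2 1 R E) N - fps_nth (fps_pc 2 2 2 L E) N
      + fps_nth (fps_pc 2 2 1 E Q) N - fps_nth (fps_pc 2 2 2 E Q) N = 0"
    using arg_cong[OF identity, of "\<lambda>F. fps_nth F N"] by simp
  then have "differential \<pi> 2 (fps_nth E N) = 0"
    using fps_pc_leading_right(2)[of 1 2 2 R E N] fps_pc_leading_right(2)[of 2 2 2 L E N]
      fps_pc_leading_left(2)[of 1 2 2 E Q N] fps_pc_leading_left(2)[of 2 2 2 E Q N] LR LR0 E Q Q0
    by (simp add: differential_2)
  then show ?thesis
    by (simp add: E_def Q_def)
qed

text \<open>The first possibly nonzero coefficient \<open>z\<close> of the defect is a cocycle,
  hence the differential of some \<open>\<psi>\<close>. Adding \<open>\<psi>\<close> to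
  \<open>\<phi>\<close> in the same order subtracts exactly \<open>z\<close> and leaves the lower
  orders alone.\<close>

lemma fps_defect_correction:
  assumes "multiplication \<pi>" "cohomology \<pi> 2 = {coboundaries \<pi> 2}" "deformation \<pi> P"
    and \<phi>: "\<phi> \<in> fps_Op 1" "fps_nth \<phi> 0 = ident"
    and low: "\<And>k. k \<le> n \<Longrightarrow> fps_nth (fps_defect P (fps_const \<pi>) \<phi>) k = 0"
  obtains \<phi>' where "\<phi>' \<in> fps_Op 1" "\<And>k. k \<le> n \<Longrightarrow> fps_nth \<phi>' k = fps_nth \<phi> k"
    "\<And>k. k \<le> Suc n \<Longrightarrow> fps_nth (fps_defect P (fps_const \<pi>) \<phi>') k = 0"
proof -
  interpret F: ns_operad fps_scale fps_Op fps_pc "fps_const ident"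
    by (rule ns_operad_fps)
  define Q where "Q = fps_const \<pi>"
  have \<pi>: "\<pi> \<in> Op 2" "P \<in> fps_Op 2" "fps_nth P 0 = \<pi>" and Q: "Q \<in> fps_Op 2" "fps_nth Q 0 = \<pi>"
    using assms by (auto simp: multiplication_def deformation_def Q_def fps_const_mem_fps_Op)
  define z where "z = fps_nth (fps_defect P Q \<phi>) (Suc n)"
  have "z \<in> Op 2"
    using fps_Op_nth fps_defect_closed \<pi> Q \<phi> unfolding z_def by blast
  moreover have "differential \<pi> 2 z = 0"
    unfolding z_def Q_def using assms by (intro fps_defect_cocycle) auto
  ultimately obtain \<psi> where \<psi>: "\<psi> \<in> Op 1" "differential \<pi> 1 \<psi> = z"
    using coboundary_if_cohomology_2_trivial \<pi>(1) assms(2) by blast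
  define \<delta> where "\<delta> = Abs_fps (\<lambda>k. if k = Suc n then \<psi> else 0)"
  have \<delta>: "\<delta> \<in> fps_Op 1" "\<And>k. k < Suc n \<Longrightarrow> fps_nth \<delta> k = 0" "fps_nth \<delta> (Suc n) = \<psi>"
    using \<psi> by (auto simp: \<delta>_def fps_Op_def Op_zero)
  note perturb = fps_defect_perturb[where N = "Suc n", OF \<pi>(2) Q(1) \<phi> \<delta>(1,2) zero_less_Suc \<pi>(3) Q(2)]
  show ?thesis
  proof (rule that[of "\<phi> + \<delta>"])
    show "\<phi> + \<delta> \<in> fps_Op 1"
      using \<phi> \<delta> by (simp add: F.Op_add)
    show "fps_nth (\<phi> + \<delta>) k = fps_nth \<phi> k" if "k \<le> n" for k
      using \<delta>(2) that by simp
    show "fps_nth (fps_defect P (fps_const \<pi>) (\<phi> + \<delta>)) k = 0" if "k \<le> Suc n" for k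
    proof (cases "k = Suc n")
      case True
      then show ?thesis
        using perturb(2) \<psi> \<delta>(3) by (simp add: z_def flip: Q_def)
    next
      case False
      then show ?thesis
        using perturb(1)[OF _ le_neq_implies_less[OF that False]] low[of k] that by (simp flip: Q_def)
    qed
  qed
qed

section \<open>Construction of the equivalence as a limit\<close>

lemma rigid_if_cohomology_2_trivial:
  assumes "multiplication \<pi>" "cohomology \<pi> 2 = {coboundaries \<pi> 2}"
  shows "rigid \<pi>"
  unfolding rigid_def equivalent_deformations_iff_defect
proof (intro allI impI)
  fix P
  assume P: "deformation \<pi> P"
  interpret F: ns_operad fps_scale fps_Op fps_pc "fps_const ident"
    by (rule ns_operad_fps)
  define Q where "Q = fps_const \<pi>"
  have \<pi>: "\<pi> \<in> Op 2" "P \<in> fps_Op 2" "fps_nth P 0 = \<pi>" and Q: "Q \<in> fps_Op 2" "fps_nth Q 0 = \<pi>"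
    using assms P by (auto simp: multiplication_def deformation_def Q_def fps_const_mem_fps_Op)
  define good where "good n \<phi> \<longleftrightarrow> \<phi> \<in> fps_Op 1 \<and> fps_nth \<phi> 0 = ident \<and>
    (\<forall>k\<le>n. fps_nth (fps_defect P Q \<phi>) k = 0)" for n \<phi>
  \<comment> \<open>Each correction depends on a choice of primitive, so the sequence of
    approximations comes from dependent choice.\<close>
  have "\<exists>\<Phi>. \<forall>n. good n (\<Phi> n) \<and> (\<forall>k\<le>n. fps_nth (\<Phi> (Suc n)) k = fps_nth (\<Phi> n) k)"
  proof (rule dependent_nat_choice)
    \<comment> \<open>At order 0 the identity series gives \<open>\<pi> - \<pi>\<close>, because
      \<open>P\<close> and \<open>Q\<close> have the same constant term.\<close>
    have "fps_nth (fps_defect P Q (fps_const ident)) 0 = 0"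
      using \<pi> Q by (simp add: fps_defect_def fps_gamma_def fps_pc_nth pc_ident_left pc_ident_right)
    then have "good 0 (fps_const ident)"
      using F.ident_closed by (simp add: good_def)
    then show "\<exists>\<phi>. good 0 \<phi>" ..
  next
    fix \<phi> n
    assume "good n \<phi>"
    then obtain \<phi>' where "\<phi>' \<in> fps_Op 1" "\<And>k. k \<le> n \<Longrightarrow> fps_nth \<phi>' k = fps_nth \<phi> k"
      "\<And>k. k \<le> Suc n \<Longrightarrow> fps_nth (fps_defect P Q \<phi>') k = 0"
      using fps_defect_correction[OF assms P, of \<phi> n] unfolding good_def Q_def by blast
    with \<open>good n \<phi>\<close> show "\<exists>\<phi>'. good (Suc n) \<phi>' \<and> (\<forall>k\<le>n. fps_nth \<phi>' k = fps_nth \<phi> k)"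
      unfolding good_def by (metis le0)
  qed
  then obtain \<Phi> where \<Phi>: "\<And>n. good n (\<Phi> n)"
    and step: "\<And>n k. k \<le> n \<Longrightarrow> fps_nth (\<Phi> (Suc n)) k = fps_nth (\<Phi> n) k"
    by blast
  have stable: "fps_nth (\<Phi> n) k = fps_nth (\<Phi> k) k" if "k \<le> n" for n k
    using that by (induction n rule: dec_induct) (auto simp: step)
  \<comment> \<open>Coefficient \<open>n\<close> no longer changes from stage \<open>n\<close> on,
    so the diagonal is the limit of the approximations in the \<open>t\<close>-adic sense.\<close>
  define \<phi> where "\<phi> = Abs_fps (\<lambda>n. fps_nth (\<Phi> n) n)"
  have \<phi>: "\<phi> \<in> fps_Op 1" "fps_nth \<phi> 0 = ident"
    using \<Phi> by (auto simp: \<phi>_def good_def fps_Op_def)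
  have "fps_nth (fps_defect P Q \<phi>) n = 0" for n
  proof -
    note \<Phi>n = \<Phi>[of n, unfolded good_def]
    \<comment> \<open>The limit differs from \<open>\<Phi> n\<close> only in orders above
      \<open>n\<close>, so perturbation from order \<open>Suc n\<close> on leaves coefficient
      \<open>n\<close> of the defect as it is.\<close>
    have "fps_nth (fps_defect P Q (\<Phi> n + (\<phi> - \<Phi> n))) n = fps_nth (fps_defect P Q (\<Phi> n)) n"
    proof (rule fps_defect_perturb(1)[where N = "Suc n" and \<pi> = \<pi>])
      show "\<phi> - \<Phi> n \<in> fps_Op 1"
        using \<phi> \<Phi>n by (simp add: F.Op_diff)
      show "fps_nth (\<phi> - \<Phi> n) k = 0" if "k < Suc n" for k
        using stable[of k n] that by (simp add: \<phi>_def)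
    qed (use \<pi> Q \<Phi>n in auto)
    then show ?thesis
      using \<Phi>n by simp
  qed
  then show "\<exists>\<phi>\<in>fps_Op 1. fps_nth \<phi> 0 = ident \<and> fps_defect P (fps_const \<pi>) \<phi> = 0"
    using \<phi> by (auto simp: fps_eq_iff Q_def)
qed

end

theorem theorem3p5:
  fixes scale :: "'k::field_char_0 \<Rightarrow> 'a::ab_group_add \<Rightarrow> 'a"
    and Op :: "nat \<Rightarrow> 'a set"
    and pc :: "nat \<Rightarrow> nat \<Rightarrow> nat \<Rightarrow> 'a \<Rightarrow> 'a \<Rightarrow> 'a"
    and ident \<pi> :: 'a
  assumes "ns_operad scale Op pc ident"
    and "ns_operad.multiplication scale Op pc \<pi>"
    and "ns_operad.cohomology scale Op pc \<pi> 2 = {ns_operad.coboundaries scale Op pc \<pi> 2}"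
  shows "ns_operad.rigid scale Op pc ident \<pi>"
  using assms by (rule ns_operad.rigid_if_cohomology_2_trivial)

end
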